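(* Let $X=(X_n)_{n\in\mathbb{Z}}$ be the i.i.d. increments of a skip-free to the left random walk and let $[\mathbf{T},0]$ be the connected component of $0$ (rooted at $0$) in the record graph of $(\mathbb{Z},X)$. If $\mathbb{E}[X_0]<0$, then the unimodular Family Tree $[\mathbf{T},0]$ is almost surely of class $\mathcal{F}/\mathcal{F}$.
   Context: **Increments.** "I.i.d. increments of a skip-free to the left random walk" means: $X=(X_n)_{n\in\mathbb{Z}}$ is i.i.d., each $X_n$ takes values in $\{-1,0,1,2,\dots\}$, $\mathbb{P}[X_0=-1]>0$ and $\mathbb{E}[X_0]<\infty$. **Record graph.** For an integer-valued sequence $x$ the record map is $R_x(i)=\inf\{j>i:\sum_{l=i}^{j-1}x_l\ge 0\}$ if the infimum exists and $R_x(i)=i$ otherwise. The record graph of $(\mathbb{Z},x)$ is the directed graph on $\mathbb{Z}$ with edges $(i,R_x(i))$ for all $i$ with $R_x(i)\ne i$. **Class $\mathcal{F}/\mathcal{F}$.** A Family Tree (a locally finite directed tree in which each vertex has out-degree at most $1$) is of class $\mathcal{F}/\mathcal{F}$ if it has finitely many vertices. (The tree $[\mathbf{T},0]$ is unimodular, i.e. satisfies the Mass Transport Principle; this is known because $X$ is stationary.) *)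

theory Defs
  imports "HOL-Probability.Probability" "Graph_Theory.Digraph_Component"
begin

text \<open>If some partial sum from \<open>i\<close> on is nonnegative, the set below is nonempty and bounded below
  by \<open>i\<close>, so \<^term>\<open>Inf\<close> on \<^typ>\<open>int\<close> is its least element.\<close>

definition record_map :: "(int \<Rightarrow> int) \<Rightarrow> int \<Rightarrow> int" where
  "record_map x i =
     (if \<exists>j>i. (\<Sum>l=i..<j. x l) \<ge> 0 then Inf {j. j > i \<and> (\<Sum>l=i..<j. x l) \<ge> 0} else i)"

definition record_graph :: "(int \<Rightarrow> int) \<Rightarrow> int pair_pre_digraph" where
  "record_graph x = \<lparr> pverts = UNIV, parcs = {(i, record_map x i) | i. record_map x i \<noteq> i} \<rparr>"

text \<open>Connectedness is weak: paths may traverse arcs in either direction.\<close>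

definition connected_component_at :: "'a pair_pre_digraph \<Rightarrow> 'a \<Rightarrow> 'a pair_pre_digraph" where
  "connected_component_at G v =
     (let C = {w. reachable (with_proj (mk_symmetric (with_proj G))) v w}
      in \<lparr> pverts = C, parcs = parcs G \<inter> C \<times> C \<rparr>)"

text \<open>A directed tree is an orientation of an undirected tree. The predicate
  \<^const>\<open>Digraph_Component.tree\<close> only excludes directed cycles, so undirected cycles are excluded
  here explicitly. In \<^const>\<open>mk_symmetric\<close> every arc yields a degenerate cycle of length 2; the
  genuine cycles of length at most 2 (loops and antiparallel pairs) are excluded by asymmetry.\<close>

definition directed_tree :: "'a pair_pre_digraph \<Rightarrow> bool" where
  "directed_tree G \<longleftrightarrow>
     pair_wf_digraph G \<and> Digraph_Component.connected (with_proj G) \<and> asym (parcs G) \<and>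
     \<not> (\<exists>p. pre_digraph.cycle (with_proj (mk_symmetric (with_proj G))) p \<and> length p \<ge> 3)"

text \<open>The out-degree bound is only meaningful together with finiteness of the set of out-arcs,
  since \<^const>\<open>out_degree\<close> is a cardinality with value 0 on infinite sets.\<close>

definition family_tree :: "'a pair_pre_digraph \<Rightarrow> bool" where
  "family_tree G \<longleftrightarrow>
     directed_tree G \<and>
     (\<forall>v\<in>pverts G. finite (in_arcs (with_proj G) v) \<and> finite (out_arcs (with_proj G) v)) \<and>
     (\<forall>v\<in>pverts G. out_degree (with_proj G) v \<le> 1)"

definition class_F_F :: "'a pair_pre_digraph \<Rightarrow> bool" where
  "class_F_F G \<longleftrightarrow> family_tree G \<and> finite (pverts G)"

text \<open>Since the increments are bounded below by \<open>-1\<close>, finiteness of the expectation of \<open>X 0\<close> is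
  integrability.\<close>

definition skip_free_left_increments :: "'w measure \<Rightarrow> (int \<Rightarrow> 'w \<Rightarrow> int) \<Rightarrow> bool" where
  "skip_free_left_increments M X \<longleftrightarrow>
     prob_space.indep_vars M (\<lambda>_. count_space UNIV) X UNIV \<and>
     (\<forall>n. distr M (count_space UNIV) (X n) = distr M (count_space UNIV) (X 0)) \<and>
     (\<forall>n. AE w in M. X n w \<ge> -1) \<and>
     measure M {w \<in> space M. X 0 w = -1} > 0 \<and>
     integrable M (\<lambda>w. real_of_int (X 0 w))"

end

theory Submission
  imports Defs
begin

text \<open>
  Call \<open>k\<close> a last exit if the walk stays strictly below its value at \<open>k\<close> after time \<open>k\<close>. No edge of the
  record graph jumps over a last exit: a record epoch beyond \<open>k\<close> of some \<open>i < k\<close> would lie strictly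
  below the walk at \<open>k\<close>, which is strictly below the walk at \<open>i\<close>. Hence the component of 0 is finite as
  soon as there are last exits on both sides of 0, which is the case if the walk tends to
  \<open>-\<infinity>\<close> at \<open>+\<infinity>\<close> and to \<open>+\<infinity>\<close> at \<open>-\<infinity>\<close>. For the drift to \<open>-\<infinity>\<close>, the maximal ergodic inequality,
  applied to the increments plus a small constant, shows that the walk stays below a line of negative
  slope with positive probability; by Kolmogorov's 0-1 law it tends to \<open>-\<infinity>\<close> almost surely.
\<close>

section \<open>Records of a deterministic path\<close>

lemma sum_int_atLeastLessThan_concat:
  fixes x :: "int \<Rightarrow> 'a::comm_monoid_add"
  assumes "i \<le> k" "k \<le> j"
  shows "(\<Sum>l=i..<j. x l) = (\<Sum>l=i..<k. x l) + (\<Sum>l=k..<j. x l)"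
proof -
  have "{i..<j} = {i..<k} \<union> {k..<j}" using assms by auto
  then show ?thesis by (simp add: sum.union_disjoint)
qed

lemma record_map_neqD:
  assumes "record_map x i \<noteq> i"
  shows "i < record_map x i" "(\<Sum>l=i..<record_map x i. x l) \<ge> 0"
    "\<And>k. i < k \<Longrightarrow> k < record_map x i \<Longrightarrow> (\<Sum>l=i..<k. x l) < 0"
proof -
  let ?A = "{j. j > i \<and> (\<Sum>l=i..<j. x l) \<ge> 0}"
  obtain j where j: "j \<in> ?A"
    using assms unfolding record_map_def by (auto split: if_splits)
  \<comment> \<open>Cutting the set at a known member \<open>j\<close> leaves finitely many
    candidates; their minimum is also least in the whole set, so \<open>Inf\<close> is
    attained.\<close>
  then have fin: "finite (?A \<inter> {..j})" "?A \<inter> {..j} \<noteq> {}"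
    by (auto intro: finite_subset[of _ "{i..j}"])
  define k where "k = Min (?A \<inter> {..j})"
  have k: "k \<in> ?A" "k \<le> j" using Min_in[OF fin] by (auto simp: k_def)
  have least: "k \<le> l" if "l \<in> ?A" for l
    using that k(2) fin(1) by (cases "l \<le> j") (auto simp: k_def intro!: Min_le)
  have R: "record_map x i = k"
    using cInf_eq_minimum[OF k(1) least] j unfolding record_map_def by auto
  show "i < record_map x i" "(\<Sum>l=i..<record_map x i. x l) \<ge> 0"
    using k unfolding R by auto
  show "(\<Sum>l=i..<k'. x l) < 0" if "i < k'" "k' < record_map x i" for k'
    using that least[of k'] unfolding R by force
qed

definition last_exit :: "(int \<Rightarrow> int) \<Rightarrow> int \<Rightarrow> bool" where
  "last_exit x k \<longleftrightarrow> (\<forall>j>k. (\<Sum>l=k..<j. x l) < 0)"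

text \<open>This barrier confines the components. The case \<open>i = k\<close> shows that a last
  exit has no outgoing edge.\<close>

lemma record_map_le_last_exit:
  assumes "last_exit x k" "i \<le> k"
  shows "record_map x i \<le> k"
proof (rule ccontr)
  assume *: "\<not> record_map x i \<le> k"
  then have neq: "record_map x i \<noteq> i" using assms by auto
  note R = record_map_neqD[OF neq]
  have "(\<Sum>l=k..<record_map x i. x l) < 0"
    using assms(1) * by (auto simp: last_exit_def)
  \<comment> \<open>For \<open>i = k\<close> the sum is empty; for \<open>i < k\<close> the epoch
    \<open>k\<close> precedes the first record, so the sum is negative.\<close>
  moreover have "(\<Sum>l=i..<k. x l) \<le> 0"
    using R(3)[of k] assms(2) * by (cases "i = k") (auto simp: less_le)
  ultimately show False
    using R(2) sum_int_atLeastLessThan_concat[of i k "record_map x i" x] assms(2) * by simp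
qed

text \<open>The last time from \<open>m\<close> on at which the walk is at least \<open>S m\<close>
  is a last exit. It exists because the drift leaves only finitely many such times.\<close>

lemma ex_last_exit_ge:
  fixes x S :: "int \<Rightarrow> int"
  assumes S: "\<And>i j. i \<le> j \<Longrightarrow> (\<Sum>l=i..<j. x l) = S j - S i"
    and lim: "filterlim S at_bot at_top"
  obtains k where "k \<ge> m" "S k \<ge> S m" "last_exit x k"
proof -
  define A where "A = {j. j \<ge> m \<and> S j \<ge> S m}"
  obtain N where N: "\<And>j. j \<ge> N \<Longrightarrow> S j < S m"
    using lim[unfolded filterlim_at_bot eventually_at_top_linorder, rule_format, of "S m - 1"]
    by force
  have "A \<subseteq> {m..N}"
  proof
    fix j assume "j \<in> A"
    then show "j \<in> {m..N}" using N[of j] by (cases "j \<le> N") (auto simp: A_def)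
  qed
  then have fin: "finite A" by (rule finite_subset) simp
  have "m \<in> A" by (simp add: A_def)
  then have mem: "Max A \<in> A" using fin Max_in by blast
  have "S j < S (Max A)" if "j > Max A" for j
  proof -
    have "j \<notin> A" using that fin by (auto dest: Max_ge)
    then show ?thesis using mem that by (auto simp: A_def)
  qed
  then have "last_exit x (Max A)" by (auto simp: last_exit_def S)
  with mem show ?thesis by (intro that[of "Max A"]) (auto simp: A_def)
qed

text \<open>The right exit comes from starting at 0. On the left the walk climbs to plus infinity,
  so some start there exceeds the bound of the walk on nonnegative times; an exit at least as high
  must be negative.\<close>

lemma ex_last_exits_around_0:
  fixes x :: "int \<Rightarrow> int"
  assumes right: "filterlim (\<lambda>n. \<Sum>i<n. x (int i)) at_bot sequentially"
    and left: "filterlim (\<lambda>n. \<Sum>i<n. x (- 1 - int i)) at_bot sequentially"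
  obtains a b where "a < 0" "0 \<le> b" "last_exit x a" "last_exit x b"
proof -
  \<comment> \<open>The walk normalised by \<open>S 0 = 0\<close>: on either side of 0 one of the
    two sums is empty.\<close>
  define S where "S k = (\<Sum>l=0..<k. x l) - (\<Sum>l=k..<0. x l)" for k :: int
  have S: "(\<Sum>l=i..<j. x l) = S j - S i" if "i \<le> j" for i j
  proof -
    consider "0 \<le> i" | "i < 0" "0 \<le> j" | "j < 0" by linarith
    then show ?thesis
    proof cases
      case 1
      then show ?thesis using that sum_int_atLeastLessThan_concat[of 0 i j x] by (simp add: S_def)
    next
      case 2
      then show ?thesis using sum_int_atLeastLessThan_concat[of i 0 j x] by (simp add: S_def)
    next
      case 3
      then show ?thesis using that sum_int_atLeastLessThan_concat[of i j 0 x] by (simp add: S_def)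
    qed
  qed
  have S_nat: "S (int n) = (\<Sum>i<n. x (int i))" for n
  proof (induction n)
    case (Suc n)
    have "{int n..<int (Suc n)} = {int n}" by auto
    then have "S (int (Suc n)) = S (int n) + x (int n)"
      using S[of "int n" "int (Suc n)"] by simp
    with Suc show ?case by simp
  qed (simp add: S_def)
  \<comment> \<open>The increment \<open>x l\<close> leads from time \<open>l\<close> to
    \<open>l + 1\<close>, so the backward walk starts with index -1.\<close>
  have S_neg: "S (- int n) = - (\<Sum>i<n. x (- 1 - int i))" for n
  proof (induction n)
    case (Suc n)
    have "{- int (Suc n)..<- int n} = {- 1 - int n}" by auto
    then have "S (- int (Suc n)) = S (- int n) - x (- 1 - int n)"
      using S[of "- int (Suc n)" "- int n"] by simp
    with Suc show ?case by simp
  qed (simp add: S_def)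
  have lim: "filterlim S at_bot at_top"
    unfolding filterlim_at_bot
  proof
    fix Z :: int
    obtain N where N: "\<And>n. n \<ge> N \<Longrightarrow> S (int n) \<le> Z"
      using right by (auto simp: filterlim_at_bot eventually_sequentially S_nat)
    have "S k \<le> Z" if "k \<ge> int N" for k
      using N[of "nat k"] that by simp
    then show "\<forall>\<^sub>F k in at_top. S k \<le> Z" by (auto simp: eventually_at_top_linorder)
  qed
  obtain b where b: "b \<ge> 0" "last_exit x b"
    using ex_last_exit_ge[OF S lim, of 0] by metis
  obtain N where N: "\<And>k. k \<ge> N \<Longrightarrow> S k \<le> 0"
    using lim by (auto simp: filterlim_at_bot eventually_at_top_linorder)
  \<comment> \<open>The 0 bounds the walk from time \<open>N\<close> on and keeps the set nonempty
    if \<open>N\<close> is negative.\<close>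
  define B where "B = Max (insert 0 (S ` {0..N}))"
  have B: "S k \<le> B" if "k \<ge> 0" for k
  proof (cases "k \<ge> N")
    case True
    have "0 \<le> B" by (simp add: B_def)
    with N[OF True] show ?thesis by simp
  next
    case False
    then show ?thesis using that unfolding B_def by (intro Max_ge) auto
  qed
  obtain n where "(\<Sum>i<n. x (- 1 - int i)) \<le> - B - 1"
    using left[unfolded filterlim_at_bot eventually_sequentially, rule_format, of "- B - 1"] by blast
  then have "S (- int n) > B" by (simp add: S_neg)
  then obtain a where "S a > B" "last_exit x a"
    using ex_last_exit_ge[OF S lim, of "- int n"] by (metis less_le_trans)
  moreover from this have "a < 0" using B[of a] by linarith
  ultimately show ?thesis using that b by blast
qed

section \<open>The component of the record graph\<close>

text \<open>At a minimal vertex of an undirected cycle both incident arcs point away, but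
  \<open>f\<close> allows only one outgoing arc. The two neighbours therefore agree, and
  distinctness of the vertices bounds the length.\<close>

lemma no_long_cycle_of_increasing_function:
  fixes E :: "('a::linorder \<times> 'a) set"
  assumes E: "\<And>a b. (a, b) \<in> E \<Longrightarrow> b = f a \<and> a < b"
    and p: "pcas u p u" "set p \<subseteq> E \<union> E\<inverse>" "distinct (map snd p)"
  shows "length p < 3"
proof (rule ccontr)
  define n where "n = length p"
  assume "\<not> length p < 3"
  then have n: "n \<ge> 3" by (simp add: n_def)
  then have mod_n: "i mod n < n" for i by (intro mod_less_divisor) linarith
  have walk: "fst (q ! 0) = v \<and> snd (q ! (length q - 1)) = w \<and>
      (\<forall>i. Suc i < length q \<longrightarrow> fst (q ! Suc i) = snd (q ! i))"
    if "pcas v q w" "q \<noteq> []" for v q and w :: 'a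
    using that
  proof (induction q arbitrary: v)
    case (Cons e q)
    show ?case
    proof (cases "q = []")
      case False
      then show ?thesis
        using Cons by (auto simp: nth_Cons split: nat.split)
    qed (use Cons.prems in auto)
  qed simp
  \<comment> \<open>The heads of the arcs, extended periodically: closedness of the walk makes
    consecutive values an arc of \<open>p\<close> even across the wrap-around.\<close>
  define s where "s k = snd (p ! (k mod n))" for k
  have "fst (p ! (Suc k mod n)) = s k" for k
  proof -
    have ne: "p \<noteq> []" using n by (auto simp: n_def)
    note w = walk[OF p(1) ne]
    show ?thesis
    proof (cases "Suc (k mod n) = n")
      case True
      then have "k mod n = length p - 1" by (simp add: n_def)
      with True w show ?thesis by (simp add: s_def mod_Suc)
    next
      case False
      with mod_n[of k] have "Suc (k mod n) < length p" by (simp add: n_def)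
      with False w show ?thesis by (simp add: s_def mod_Suc)
    qed
  qed
  then have "(s k, s (Suc k)) = p ! (Suc k mod n)" for k
    by (simp add: s_def prod_eq_iff)
  moreover have "p ! (Suc k mod n) \<in> set p" for k
    using mod_n unfolding n_def by (rule nth_mem)
  ultimately have arc: "(s k, s (Suc k)) \<in> E \<union> E\<inverse>" for k
    using p(2) by (metis subsetD)
  have "Min (s ` {..<n}) \<in> s ` {..<n}" using n by (intro Min_in) (auto simp: lessThan_empty_iff)
  then obtain k where k: "k < n" "s k = Min (s ` {..<n})" by auto
  have min: "s k \<le> s i" for i
  proof -
    have "s i = s (i mod n)" by (simp add: s_def)
    also have "\<dots> \<ge> s k" unfolding k(2) using n by (intro Min_le) auto
    finally show ?thesis .
  qed
  \<comment> \<open>Both neighbours of a minimal vertex of the cycle are its image under \<open>f\<close>.\<close>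
  define i where "i = k + n - 1"
  \<comment> \<open>Adding the period \<open>n\<close> yields a predecessor of \<open>k\<close>
    without truncated subtraction at \<open>k = 0\<close>.\<close>
  have i: "Suc i = k + n"  "Suc (Suc i) = Suc k + n" using n by (auto simp: i_def)
  have sk: "s (Suc i) = s k" by (simp add: i s_def)
  have "s (Suc (Suc i)) = f (s (Suc i))"
    using arc[of "Suc i"] E min[of "Suc (Suc i)"] unfolding sk by fastforce
  moreover have "s i = f (s (Suc i))"
    using arc[of i] E min[of i] unfolding sk by fastforce
  ultimately have "s (i + 2) = s i" by simp
  then have "(i + 2) mod n = i mod n"
    using nth_eq_iff_index_eq[OF p(3), of "(i + 2) mod n" "i mod n"] mod_n
    unfolding s_def n_def length_map by (simp only: nth_map) blast
  then have "n dvd 2" by (simp add: mod_eq_dvd_iff_nat)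
  with n show False by (auto dest: dvd_imp_le)
qed

lemma connected_component_at_closed:
  assumes "(a, b) \<in> parcs (mk_symmetric (with_proj G))"
    and "a \<in> pverts (connected_component_at G v)" "b \<in> pverts G"
  shows "b \<in> pverts (connected_component_at G v)"
  using assms unfolding connected_component_at_def Let_def reachable_def
  by (auto intro: rtrancl_on_into_rtrancl_on)

text \<open>The component is defined by reachability in \<open>G\<close>, whereas connectedness asks
  for paths inside the component. A path from \<open>v\<close> never leaves it, and symmetry joins
  any two vertices through \<open>v\<close>.\<close>

lemma connected_connected_component_at:
  assumes v: "v \<in> pverts G"
  shows "Digraph_Component.connected (with_proj (connected_component_at G v))"
proof -
  define H where "H = connected_component_at G v"
  let ?E = "parcs (mk_symmetric (with_proj H))"
  have vH: "v \<in> pverts H"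
    using v by (simp add: H_def connected_component_at_def Let_def reachable_def)
  have to: "(v, w) \<in> rtrancl_on (pverts H) ?E" if "w \<in> pverts H" for w
  proof -
    have "(v, w) \<in> rtrancl_on (pverts G) (parcs (mk_symmetric (with_proj G)))"
      using that by (simp add: H_def connected_component_at_def Let_def reachable_def)
    then have "w \<in> pverts H \<and> (v, w) \<in> rtrancl_on (pverts H) ?E"
    proof (induction rule: rtrancl_on_induct)
      case (step y z)
      then have z: "z \<in> pverts H"
        using connected_component_at_closed[of y z G v] by (simp add: H_def)
      then have "(y, z) \<in> ?E"
        using step by (auto simp: parcs_mk_symmetric H_def connected_component_at_def Let_def)
      with step z show ?case by (blast intro: rtrancl_on_into_rtrancl_on)
    qed (use vH in auto)
    then show ?thesis by simp
  qed
  have "sym ?E" by (auto simp: parcs_mk_symmetric intro!: symI)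
  then have "sym (rtrancl_on (pverts H) ?E)" by (rule rtrancl_on_sym)
  then have "(u, w) \<in> rtrancl_on (pverts H) ?E" if "u \<in> pverts H" "w \<in> pverts H" for u w
    using to[OF that(1)] to[OF that(2)] by (meson symD rtrancl_on_trans)
  then show ?thesis
    using vH unfolding Digraph_Component.connected_def strongly_connected_def reachable_def
    by (auto simp: H_def)
qed

text \<open>Edges point upwards, so an undirected path from 0 could leave the interval only along an
  edge from inside to beyond \<open>b\<close>, or backwards along an edge that starts at or below
  \<open>a\<close>. The two last exits exclude both.\<close>

lemma record_component_bounded:
  assumes "a < 0" "0 \<le> b" "last_exit x a" "last_exit x b"
  shows "pverts (connected_component_at (record_graph x) 0) \<subseteq> {a<..b}"
proof
  fix w assume "w \<in> pverts (connected_component_at (record_graph x) 0)"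
  then have "(0, w) \<in> rtrancl_on UNIV (parcs (mk_symmetric (with_proj (record_graph x))))"
    by (simp add: connected_component_at_def Let_def reachable_def record_graph_def)
  then show "w \<in> {a<..b}"
  proof (induction rule: rtrancl_on_induct)
    case (step y z)
    then have "z = record_map x y \<and> record_map x y \<noteq> y \<or> y = record_map x z \<and> record_map x z \<noteq> z"
      by (auto simp: parcs_mk_symmetric record_graph_def)
    then consider "z = record_map x y" "y < z" | "y = record_map x z" "z < y"
      using record_map_neqD(1) by metis
    then show ?case
      using step.IH record_map_le_last_exit[OF assms(3), of z] record_map_le_last_exit[OF assms(4), of y]
      by cases (simp, fastforce)
  qed (use assms in auto)
qed

text \<open>Acyclicity, asymmetry and the degree bound rest on two facts: arcs strictly increase,
  and each is determined by its source.\<close>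

lemma class_F_F_record_component:
  assumes "a < 0" "0 \<le> b" "last_exit x a" "last_exit x b"
  shows "class_F_F (connected_component_at (record_graph x) 0)"
proof -
  define H where "H = connected_component_at (record_graph x) 0"
  have fin: "finite (pverts H)"
    unfolding H_def using record_component_bounded[OF assms] by (rule finite_subset) simp
  have arcs: "parcs H \<subseteq> pverts H \<times> pverts H"
    by (simp add: H_def connected_component_at_def Let_def)
  then have fin_arcs: "finite (parcs H)" using fin by (blast intro: finite_subset)
  have E: "j = record_map x i \<and> i < j" if "(i, j) \<in> parcs H" for i j
    using that record_map_neqD(1)[of x i]
    by (auto simp: H_def connected_component_at_def Let_def record_graph_def)
  have "pair_wf_digraph H" using arcs by unfold_locales auto
  moreover have "Digraph_Component.connected (with_proj H)"
    unfolding H_def by (rule connected_connected_component_at) (simp add: record_graph_def)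
  moreover have "asym (parcs H)" by (rule asymI) (meson E order.asym)
  moreover have "length p < 3"
    if cycle: "pre_digraph.cycle (with_proj (mk_symmetric (with_proj H))) p" for p
  proof -
    obtain u where u: "pcas u p u" "set p \<subseteq> parcs (mk_symmetric (with_proj H))"
      "distinct (tl (pre_digraph.awalk_verts (with_proj (mk_symmetric (with_proj H))) u p))" "p \<noteq> []"
      using cycle unfolding pre_digraph.cycle_def pre_digraph.awalk_def cas_with_proj_eq with_proj_simps
      by blast
    have "set p \<subseteq> parcs H \<union> (parcs H)\<inverse>" using u(2) by (auto simp: parcs_mk_symmetric)
    \<comment> \<open>For a nonempty walk, the tail of \<open>awalk_verts\<close> lists the heads of
      its arcs, that is \<open>map snd p\<close>.\<close>
    moreover have "distinct (map snd p)"
      using u(1,3,4) pre_digraph.awalk_verts_conv'[of "with_proj (mk_symmetric (with_proj H))" u p u]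
      by (simp add: cas_with_proj_eq del: awalk_verts_with_proj_eq)
    ultimately show ?thesis using no_long_cycle_of_increasing_function[OF E u(1)] by blast
  qed
  moreover have "out_degree (with_proj H) v \<le> 1" for v
  proof -
    have "out_arcs (with_proj H) v \<subseteq> {(v, record_map x v)}"
      using E by (auto simp: out_arcs_def)
    from card_mono[OF _ this] show ?thesis by (simp add: out_degree_def)
  qed
  ultimately have "class_F_F H"
    using fin fin_arcs unfolding class_F_F_def family_tree_def directed_tree_def
    by (auto simp: in_arcs_def out_arcs_def not_le)
  then show ?thesis by (simp add: H_def)
qed

section \<open>Random walks with negative drift\<close>

lemma (in prob_space) indep_sets_reindex:
  assumes F: "indep_sets F (f ` I)" and f: "inj_on f I"
  shows "indep_sets (\<lambda>i. F (f i)) I"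
  unfolding indep_sets_def
proof (intro conjI ballI allI impI)
  fix i assume "i \<in> I"
  then show "F (f i) \<subseteq> events" using F by (auto simp: indep_sets_def)
next
  fix J A assume J: "J \<subseteq> I" "J \<noteq> {}" "finite J" and A: "A \<in> (\<Pi> i\<in>J. F (f i))"
  have inj: "inj_on f J" using f J(1) by (rule inj_on_subset)
  \<comment> \<open>The chosen events are moved to the indices \<open>f j\<close>; injectivity makes
    this well defined and preserves the product.\<close>
  define B where "B = A \<circ> the_inv_into J f"
  have B: "B (f j) = A j" if "j \<in> J" for j
    using that inj by (simp add: B_def the_inv_into_f_f)
  have "prob (\<Inter>j\<in>f ` J. B j) = (\<Prod>j\<in>f ` J. prob (B j))"
    using J A B by (intro indep_setsD[OF F]) auto
  then show "prob (\<Inter>j\<in>J. A j) = (\<Prod>j\<in>J. prob (A j))"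
    using B by (simp add: prod.reindex[OF inj])
qed

lemma (in prob_space) indep_vars_reindex:
  assumes "indep_vars N X (f ` I)" "inj_on f I"
  shows "indep_vars (\<lambda>i. N (f i)) (\<lambda>i. X (f i)) I"
  using assms unfolding indep_vars_def2 by (auto intro: indep_sets_reindex)

text \<open>Independence turns both joint laws into products of marginals, which agree factor by
  factor.\<close>

lemma (in prob_space) iid_distr_shift:
  fixes X :: "nat \<Rightarrow> 'a \<Rightarrow> 'b"
  assumes indep: "indep_vars (\<lambda>_. N) X UNIV"
    and ident: "\<And>n. distr M N (X n) = distr M N (X 0)"
  shows "distr M (\<Pi>\<^sub>M i\<in>UNIV. N) (\<lambda>w i. X (Suc i) w) = distr M (\<Pi>\<^sub>M i\<in>UNIV. N) (\<lambda>w i. X i w)"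
proof -
  have rv: "random_variable N (X i)" for i using indep by (simp add: indep_vars_def2)
  have "indep_vars (\<lambda>_. N) (\<lambda>i. X (Suc i)) UNIV"
    using indep_vars_subset[OF indep, of "range Suc"] by (intro indep_vars_reindex[where f=Suc]) auto
  then have "distr M (\<Pi>\<^sub>M i\<in>UNIV. N) (\<lambda>w i. X (Suc i) w) = (\<Pi>\<^sub>M i\<in>UNIV. distr M N (X (Suc i)))"
    using indep_vars_iff_distr_eq_PiM[where I=UNIV and M'="\<lambda>_. N" and X="\<lambda>i. X (Suc i)"] rv
    by (simp add: restrict_UNIV)
  also have "\<dots> = (\<Pi>\<^sub>M i\<in>UNIV. distr M N (X i))"
    by (intro PiM_cong refl) (metis ident)
  also have "\<dots> = distr M (\<Pi>\<^sub>M i\<in>UNIV. N) (\<lambda>w i. X i w)"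
    using indep indep_vars_iff_distr_eq_PiM[where I=UNIV and M'="\<lambda>_. N" and X=X] rv
    by (simp add: restrict_UNIV)
  finally show ?thesis .
qed

section \<open>Running maxima and the maximal ergodic inequality\<close>

text \<open>The maximum of 0 and the first \<open>n\<close> partial sums. The recursion peels off
  the first term because the sequence is to be compared with its shift.\<close>

primrec running_max :: "nat \<Rightarrow> (nat \<Rightarrow> real) \<Rightarrow> real" where
  "running_max 0 y = 0"
| "running_max (Suc n) y = max 0 (y 0 + running_max n (\<lambda>i. y (Suc i)))"

lemma running_max_nonneg: "0 \<le> running_max n y"
  by (cases n) auto

lemma running_max_mono_Suc: "running_max n y \<le> running_max (Suc n) y"
proof (induction n arbitrary: y)
  case (Suc n)
  then show ?case using Suc[of "\<lambda>i. y (Suc i)"] by (auto simp: max_def)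
qed simp

lemma running_max_mono: "m \<le> n \<Longrightarrow> running_max m y \<le> running_max n y"
  by (rule lift_Suc_mono_le[of "\<lambda>n. running_max n y"]) (rule running_max_mono_Suc)

lemma partial_sum_le_running_max: "(\<Sum>i<n. y i) \<le> running_max n y"
proof (induction n arbitrary: y)
  case (Suc n)
  then show ?case using Suc[of "\<lambda>i. y (Suc i)"] by (simp add: sum.lessThan_Suc_shift le_max_iff_disj del: sum.lessThan_Suc)
qed simp

lemma running_max_le_sum_abs: "running_max n y \<le> (\<Sum>i<n. \<bar>y i\<bar>)"
proof (induction n arbitrary: y)
  case (Suc n)
  show ?case using Suc[of "\<lambda>i. y (Suc i)"]
    by (auto simp: sum.lessThan_Suc_shift simp del: sum.lessThan_Suc intro!: add_mono add_nonneg_nonneg sum_nonneg)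
qed simp

lemma measurable_running_max [measurable]:
  "running_max n \<in> borel_measurable (\<Pi>\<^sub>M i\<in>UNIV. borel)"
proof (induction n)
  case (Suc n)
  have "(\<lambda>y i. y (Suc i)) \<in> measurable (\<Pi>\<^sub>M i\<in>UNIV. borel) (\<Pi>\<^sub>M i\<in>UNIV. (borel :: real measure))"
    by (rule measurable_PiM_single') auto
  from measurable_compose[OF this Suc] show ?case by simp
qed simp

text \<open>Garsia's pointwise inequality. A positive maximum equals \<open>y 0\<close> plus the
  maximum of the shifted sequence over one step less, which only grows with that step added; a zero
  maximum makes the left side nonpositive.\<close>

lemma running_max_diff_le:
  "running_max n y - running_max n (\<lambda>i. y (Suc i)) \<le> y 0 * indicator {0<..} (running_max n y)"
proof (cases "running_max n y > 0")
  case True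
  then obtain m where m: "n = Suc m" by (cases n) auto
  then show ?thesis
    using True running_max_mono_Suc[of m "\<lambda>i. y (Suc i)"] by (auto simp: max_def split: if_splits)
next
  case False
  then show ?thesis using running_max_nonneg[of n "\<lambda>i. y (Suc i)"] by simp
qed

text \<open>The pointwise inequality is integrated; by shift invariance both running maxima have the
  same expectation, so the left side contributes 0.\<close>

lemma (in prob_space) maximal_inequality:
  fixes X :: "nat \<Rightarrow> 'a \<Rightarrow> real"
  assumes indep: "indep_vars (\<lambda>_. borel) X UNIV"
    and ident: "\<And>n. distr M borel (X n) = distr M borel (X 0)"
    and int: "integrable M (X 0)"
  shows "0 \<le> (\<integral>w. X 0 w * indicator {0<..} (running_max n (\<lambda>i. X i w)) \<partial>M)"
proof -
  have rv [measurable]: "random_variable borel (X i)" for i using indep by (simp add: indep_vars_def2)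
  have "integrable (distr M borel (X i)) (\<lambda>x. x)" for i
    unfolding ident[of i] by (subst integrable_distr_eq) (auto simp: int)
  then have intX: "integrable M (X i)" for i
    by (subst (asm) integrable_distr_eq) auto
  have [measurable]: "(\<lambda>w i. X (g i) w) \<in> measurable M (\<Pi>\<^sub>M i\<in>UNIV. borel)" for g
    by (rule measurable_PiM_single') auto
  have intM: "integrable M (\<lambda>w. running_max n (\<lambda>i. X (g i) w))" for g
  proof (rule Bochner_Integration.integrable_bound)
    show "integrable M (\<lambda>w. \<Sum>i<n. \<bar>X (g i) w\<bar>)" using intX by auto
    show "AE w in M. norm (running_max n (\<lambda>i. X (g i) w)) \<le> norm (\<Sum>i<n. \<bar>X (g i) w\<bar>)"
      using running_max_le_sum_abs running_max_nonneg by (auto simp: abs_of_nonneg sum_nonneg)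
  qed measurable
  have "(\<integral>w. running_max n (\<lambda>i. X i w) \<partial>M) = (\<integral>y. running_max n y \<partial>distr M (\<Pi>\<^sub>M i\<in>UNIV. borel) (\<lambda>w i. X i w))"
    by (rule integral_distr[symmetric]) measurable
  also have "\<dots> = (\<integral>y. running_max n y \<partial>distr M (\<Pi>\<^sub>M i\<in>UNIV. borel) (\<lambda>w i. X (Suc i) w))"
    by (simp add: iid_distr_shift[OF indep ident])
  also have "\<dots> = (\<integral>w. running_max n (\<lambda>i. X (Suc i) w) \<partial>M)"
    by (rule integral_distr) measurable
  finally have "0 = (\<integral>w. running_max n (\<lambda>i. X i w) - running_max n (\<lambda>i. X (Suc i) w) \<partial>M)"
    using intM[of id] intM[of Suc] by simp
  also have "\<dots> \<le> (\<integral>w. X 0 w * indicator {0<..} (running_max n (\<lambda>i. X i w)) \<partial>M)"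
  proof (rule integral_mono)
    show "integrable M (\<lambda>w. running_max n (\<lambda>i. X i w) - running_max n (\<lambda>i. X (Suc i) w))"
      using intM[of id] intM[of Suc] by simp
    show "integrable M (\<lambda>w. X 0 w * indicator {0<..} (running_max n (\<lambda>i. X i w)))"
      by (rule Bochner_Integration.integrable_bound[OF int]) (auto simp: indicator_def)
  qed (rule running_max_diff_le)
  finally show ?thesis .
qed

text \<open>Otherwise the indicators in the maximal inequality tend to 1 almost surely, and
  dominated convergence makes the mean nonnegative.\<close>

lemma (in prob_space) prob_never_positive:
  fixes X :: "nat \<Rightarrow> 'a \<Rightarrow> real"
  assumes indep: "indep_vars (\<lambda>_. borel) X UNIV"
    and ident: "\<And>n. distr M borel (X n) = distr M borel (X 0)"
    and int: "integrable M (X 0)"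
    and neg: "(\<integral>w. X 0 w \<partial>M) < 0"
  shows "\<not> (AE w in M. \<exists>n. (\<Sum>i<n. X i w) > 0)"
proof
  assume AE: "AE w in M. \<exists>n. (\<Sum>i<n. X i w) > 0"
  have rv [measurable]: "random_variable borel (X i)" for i using indep by (simp add: indep_vars_def2)
  have [measurable]: "(\<lambda>w i. X i w) \<in> measurable M (\<Pi>\<^sub>M i\<in>UNIV. borel)"
    by (rule measurable_PiM_single') auto
  have "(\<lambda>n. \<integral>w. X 0 w * indicator {0<..} (running_max n (\<lambda>i. X i w)) \<partial>M) \<longlonglongrightarrow> (\<integral>w. X 0 w \<partial>M)"
  proof (rule integral_dominated_convergence[where w="\<lambda>w. \<bar>X 0 w\<bar>"])
    show "AE w in M. (\<lambda>n. X 0 w * indicator {0<..} (running_max n (\<lambda>i. X i w))) \<longlonglongrightarrow> X 0 w"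
      using AE
    proof eventually_elim
      case (elim w)
      then obtain n where n: "(\<Sum>i<n. X i w) > 0" by blast
      have "running_max m (\<lambda>i. X i w) > 0" if "m \<ge> n" for m
        using n partial_sum_le_running_max[of "\<lambda>i. X i w" n] running_max_mono[OF that, of "\<lambda>i. X i w"] by linarith
      then have "\<forall>\<^sub>F m in sequentially. X 0 w * indicator {0<..} (running_max m (\<lambda>i. X i w)) = X 0 w"
        unfolding eventually_sequentially by (intro exI[of _ n]) simp
      then show ?case by (rule tendsto_eventually)
    qed
  qed (use int in \<open>auto simp: indicator_def\<close>)
  then have "0 \<le> (\<integral>w. X 0 w \<partial>M)"
    by (rule LIMSEQ_le_const) (use maximal_inequality[OF indep ident int] in auto)
  with neg show False by simp
qed

section \<open>Zero-one law and drift to minus infinity\<close>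

text \<open>Countably many thresholds suffice, which makes the divergence event visibly
  measurable.\<close>

lemma filterlim_at_bot_iff_nat:
  fixes f :: "'b \<Rightarrow> real"
  shows "filterlim f at_bot F \<longleftrightarrow> (\<forall>k. \<forall>\<^sub>F x in F. f x \<le> - real k)"
proof
  assume *: "\<forall>k. \<forall>\<^sub>F x in F. f x \<le> - real k"
  show "filterlim f at_bot F" unfolding filterlim_at_bot
  proof
    fix Z :: real
    obtain k where "- Z \<le> real k" using real_arch_simple by blast
    then show "\<forall>\<^sub>F x in F. f x \<le> Z"
      using *[rule_format, of k] by (auto elim: eventually_mono)
  qed
qed (auto simp: filterlim_at_bot)

text \<open>Dropping the first \<open>m\<close> increments changes the later sums by a constant, so
  divergence is a tail event.\<close>

lemma (in prob_space) partial_sums_at_bot_0_1: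
  fixes X :: "nat \<Rightarrow> 'a \<Rightarrow> real"
  assumes indep: "indep_vars (\<lambda>_. borel) X UNIV"
  defines "T \<equiv> {w\<in>space M. filterlim (\<lambda>n. \<Sum>i<n. X i w) at_bot sequentially}"
  shows "T \<in> events" "prob T = 0 \<or> prob T = 1"
proof -
  define A where "A i = {X i -` B \<inter> space M | B. B \<in> sets borel}" for i
  have rv [measurable]: "random_variable borel (X i)" for i using indep by (simp add: indep_vars_def2)
  have A: "indep_sets A UNIV" using indep by (simp add: indep_vars_def2 A_def[abs_def])
  have sub: "A i \<subseteq> Pow (space M)" for i by (auto simp: A_def)
  have sa: "sigma_algebra (space M) (A i)" for i
    using sets.sigma_algebra_axioms[of "vimage_algebra (space M) (X i) borel"]
    by (simp add: A_def sets_vimage_algebra2)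
  show T_ev: "T \<in> events" unfolding T_def filterlim_at_bot_iff_nat eventually_sequentially
    by measurable
  have "T \<in> sigma_sets (space M) (\<Union> (A ` {m..}))" for m
  proof -
    \<comment> \<open>The sigma-algebra of the increments from time \<open>m\<close> on; membership
      of \<open>T\<close> is proved as measurability with respect to it.\<close>
    define N where "N = sigma (space M) (\<Union> (A ` {m..}))"
    have sp: "space N = space M" using sub unfolding N_def by (intro space_measure_of) blast
    have sets: "sets N = sigma_sets (space M) (\<Union> (A ` {m..}))"
      using sub unfolding N_def by (intro sets_measure_of) blast
    have [measurable]: "X (m + i) \<in> borel_measurable N" for i
    proof (rule measurableI)
      fix B :: "real set" assume "B \<in> sets borel"
      then have "X (m + i) -` B \<inter> space M \<in> A (m + i)" unfolding A_def by blast
      then show "X (m + i) -` B \<inter> space N \<in> sets N"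
        unfolding sets sp by (intro sigma_sets.Basic) auto
    qed simp
    have "filterlim (\<lambda>n. \<Sum>i<n. X i w) at_bot sequentially \<longleftrightarrow>
      filterlim (\<lambda>n. \<Sum>i<n. X (m + i) w) at_bot sequentially" for w
    proof -
      have split: "(\<Sum>i<n + m. X i w) = (\<Sum>i<m. X i w) + (\<Sum>i<n. X (m + i) w)" for n
        by (induction n) (auto simp: add_ac)
      have "filterlim (\<lambda>n. \<Sum>i<n. X i w) at_bot sequentially \<longleftrightarrow>
          filterlim (\<lambda>n. \<Sum>i<n + m. X i w) at_bot sequentially"
        unfolding filterlim_iff by (subst eventually_sequentially_seg[of _ m, symmetric]) simp
      then show ?thesis
        by (simp only: split filterlim_tendsto_add_at_bot_iff[OF tendsto_const])
    qed
    then have "T = {w\<in>space N. filterlim (\<lambda>n. \<Sum>i<n. X (m + i) w) at_bot sequentially}"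
      by (simp add: T_def sp)
    also have "\<dots> \<in> sets N" unfolding filterlim_at_bot_iff_nat eventually_sequentially by measurable
    finally show ?thesis by (simp add: sets)
  qed
  then have "T \<in> tail_events A" by (auto simp: tail_events_def)
  then show "prob T = 0 \<or> prob T = 1" by (rule kolmogorov_0_1_law[OF sa A])
qed

lemma (in prob_space) AE_partial_sums_at_bot:
  fixes X :: "nat \<Rightarrow> 'a \<Rightarrow> real"
  assumes indep: "indep_vars (\<lambda>_. borel) X UNIV"
    and ident: "\<And>n. distr M borel (X n) = distr M borel (X 0)"
    and int: "integrable M (X 0)"
    and neg: "(\<integral>w. X 0 w \<partial>M) < 0"
  shows "AE w in M. filterlim (\<lambda>n. \<Sum>i<n. X i w) at_bot sequentially"
proof -
  \<comment> \<open>Adding half of the absolute drift keeps the mean negative, while nonpositive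
    sums of \<open>X i w + e\<close> hold the walk below a line of slope \<open>- e\<close>.\<close>
  define e where "e = - (\<integral>w. X 0 w \<partial>M) / 2"
  have e: "e > 0" using neg by (simp add: e_def)
  define T where "T = {w\<in>space M. filterlim (\<lambda>n. \<Sum>i<n. X i w) at_bot sequentially}"
  have rv [measurable]: "random_variable borel (X i)" for i using indep by (simp add: indep_vars_def2)
  have T: "T \<in> events" "prob T = 0 \<or> prob T = 1"
    unfolding T_def by (rule partial_sums_at_bot_0_1[OF indep])+
  have "prob T \<noteq> 0"
  proof
    assume "prob T = 0"
    then have "AE w in M. w \<notin> T" using T(1) by (simp add: prob_eq_0)
    then have "AE w in M. \<exists>n. (\<Sum>i<n. X i w + e) > 0"
    proof (rule AE_mp, intro AE_I2 impI)
      fix w assume w: "w \<in> space M" "w \<notin> T"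
      show "\<exists>n. (\<Sum>i<n. X i w + e) > 0"
      proof (rule ccontr)
        assume nonpos: "\<nexists>n. (\<Sum>i<n. X i w + e) > 0"
        then have le: "(\<Sum>i<n. X i w) \<le> - e * real n" for n
        proof -
          have "(\<Sum>i<n. X i w + e) \<le> 0" using nonpos by (simp add: not_less)
          then show ?thesis by (simp add: sum.distrib algebra_simps)
        qed
        have "filterlim (\<lambda>n. - e * real n) at_bot sequentially"
          using e by (intro filterlim_tendsto_neg_mult_at_bot[OF tendsto_const _ filterlim_real_sequentially]) auto
        then have "filterlim (\<lambda>n. \<Sum>i<n. X i w) at_bot sequentially"
          by (rule filterlim_at_bot_mono) (intro always_eventually allI le)
        with w show False by (simp add: T_def)
      qed
    qed
    moreover have "\<not> (AE w in M. \<exists>n. (\<Sum>i<n. X i w + e) > 0)"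
    proof (rule prob_never_positive)
      show "indep_vars (\<lambda>_. borel) (\<lambda>n w. X n w + e) UNIV"
        using indep by (rule indep_vars_compose2) simp
      have "distr M borel (\<lambda>w. X n w + e) = distr (distr M borel (X n)) borel (\<lambda>x. x + e)" for n
        by (subst distr_distr) (auto simp: comp_def)
      then show "distr M borel (\<lambda>w. X n w + e) = distr M borel (\<lambda>w. X 0 w + e)" for n
        by (simp only: ident[of n])
      show "integrable M (\<lambda>w. X 0 w + e)" using int by simp
      show "(\<integral>w. X 0 w + e \<partial>M) < 0" using int neg by (simp add: e_def prob_space)
    qed
    ultimately show False by blast
  qed
  with T have "prob T = 1" by blast
  then have "AE w in M. w \<in> T" using T(1) by (simp add: AE_in_set_eq_1)
  then show ?thesis by eventually_elim (simp add: T_def)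
qed

text \<open>An arbitrary injective \<open>f\<close> covers the forward and the backward walk
  alike.\<close>

lemma (in prob_space) AE_int_partial_sums_at_bot:
  fixes X :: "int \<Rightarrow> 'a \<Rightarrow> int" and f :: "nat \<Rightarrow> int"
  assumes indep: "indep_vars (\<lambda>_. count_space UNIV) X UNIV"
    and ident: "\<And>n. distr M (count_space UNIV) (X n) = distr M (count_space UNIV) (X 0)"
    and int: "integrable M (\<lambda>w. real_of_int (X 0 w))"
    and neg: "(\<integral>w. real_of_int (X 0 w) \<partial>M) < 0"
    and f: "inj f"
  shows "AE w in M. filterlim (\<lambda>n. \<Sum>i<n. X (f i) w) at_bot sequentially"
proof -
  have rv [measurable]: "random_variable (count_space UNIV) (X i)" for i
    using indep by (simp add: indep_vars_def2)
  have distr: "distr M borel (\<lambda>w. real_of_int (X n w)) =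
      distr (distr M (count_space UNIV) (X 0)) borel real_of_int" for n
    by (subst ident[of n, symmetric], subst distr_distr) (auto simp: comp_def)
  have ident': "distr M borel (\<lambda>w. real_of_int (X n w)) = distr M borel (\<lambda>w. real_of_int (X 0 w))" for n
    by (simp only: distr)
  have "AE w in M. filterlim (\<lambda>n. \<Sum>i<n. real_of_int (X (f i) w)) at_bot sequentially"
  proof (rule AE_partial_sums_at_bot)
    have "indep_vars (\<lambda>_. count_space UNIV) (\<lambda>i. X (f i)) UNIV"
      using indep_vars_subset[OF indep, of "range f"] f by (intro indep_vars_reindex[where f=f]) auto
    then show "indep_vars (\<lambda>_. borel) (\<lambda>i w. real_of_int (X (f i) w)) UNIV"
      by (rule indep_vars_compose2) simp
    show "distr M borel (\<lambda>w. real_of_int (X (f n) w)) = distr M borel (\<lambda>w. real_of_int (X (f 0) w))" for n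
      by (simp only: distr)
    have "integrable (distr M borel (\<lambda>w. real_of_int (X (f 0) w))) (\<lambda>x. x)"
      unfolding ident'[of "f 0"] by (subst integrable_distr_eq) (auto simp: int)
    then show "integrable M (\<lambda>w. real_of_int (X (f 0) w))"
      by (subst (asm) integrable_distr_eq) auto
    have "(\<integral>w. real_of_int (X (f 0) w) \<partial>M) = (\<integral>x. x \<partial>distr M borel (\<lambda>w. real_of_int (X (f 0) w)))"
      by (subst integral_distr) auto
    also have "\<dots> = (\<integral>w. real_of_int (X 0 w) \<partial>M)"
      unfolding ident'[of "f 0"] by (subst integral_distr) auto
    finally show "(\<integral>w. real_of_int (X (f 0) w) \<partial>M) < 0" using neg by simp
  qed
  then show ?thesis
  proof eventually_elim
    case (elim w)
    show ?case unfolding filterlim_at_bot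
    proof
      fix Z :: int
      show "\<forall>\<^sub>F n in sequentially. (\<Sum>i<n. X (f i) w) \<le> Z"
        using elim[unfolded filterlim_at_bot, rule_format, of "real_of_int Z"]
        by (simp flip: of_int_sum)
    qed
  qed
qed

theorem proposition39:
  fixes M :: "'w measure" and X :: "int \<Rightarrow> 'w \<Rightarrow> int"
  assumes "prob_space M"
    and "skip_free_left_increments M X"
    and "(\<integral>w. real_of_int (X 0 w) \<partial>M) < 0"
  shows "AE w in M. class_F_F (connected_component_at (record_graph (\<lambda>n. X n w)) 0)"
proof -
  interpret prob_space M by fact
  have X: "indep_vars (\<lambda>_. count_space UNIV) X UNIV"
    "\<And>n. distr M (count_space UNIV) (X n) = distr M (count_space UNIV) (X 0)"
    "integrable M (\<lambda>w. real_of_int (X 0 w))"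
    using assms(2) unfolding skip_free_left_increments_def by blast+
  note lim = AE_int_partial_sums_at_bot[OF X assms(3)]
  have "AE w in M. filterlim (\<lambda>n. \<Sum>i<n. X (int i) w) at_bot sequentially"
    by (rule lim) simp
  \<comment> \<open>Drift of the backward sums to minus infinity means that the two-sided walk
    climbs to plus infinity on the left.\<close>
  moreover have "AE w in M. filterlim (\<lambda>n. \<Sum>i<n. X (- 1 - int i) w) at_bot sequentially"
    by (rule lim) (auto intro: injI)
  ultimately show ?thesis
  proof eventually_elim
    case (elim w)
    then show ?case by (rule ex_last_exits_around_0) (rule class_F_F_record_component)
  qed
qed

end
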